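(* Let $n\ge 2$ be an integer with prime decomposition $n = p_1^{y_1}\cdots p_r^{y_r}$ (the $p_i$ pairwise distinct primes, $y_i>0$), and let $c\ge 1$. Then $$\tau\Gamma_{n,c}=\left\langle \overline{a},\ \gamma_2(\Gamma_{n,c})\right\rangle .$$
   Context: The group $\Gamma_n$ is $$\Gamma_n=\left\langle a,t_1,\dots,t_r \ \middle|\ t_it_j=t_jt_i\ (i\neq j),\ t_i a t_i^{-1}=a^{p_i^{y_i}}\ (1\le i\le r)\right\rangle.$$ The lower central series of a group $G$ is $\gamma_1(G)=G$, $\gamma_{k+1}(G)=[\gamma_k(G),G]$. For $c\ge 1$, $\Gamma_{n,c}=\Gamma_n/\gamma_{c+1}(\Gamma_n)$ (a nilpotent group of class $\le c$), and $\overline{a}=a\gamma_{c+1}(\Gamma_n)\in\Gamma_{n,c}$ is the image of $a$. For a nilpotent group $G$, $\tau G=\{g\in G \mid g^k=1 \text{ for some } k\ge 1\}$ denotes its torsion subgroup. *)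

theory Defs
  imports "HOL-Algebra.Generated_Groups" "HOL-Computational_Algebra.Primes"
begin

section \<open>Free groups\<close>

text \<open>A letter is a generator (flag \<open>True\<close>) or the formal inverse of one (flag \<open>False\<close>).\<close>

type_synonym 'x word = "('x \<times> bool) list"

definition words_on :: "'x set \<Rightarrow> 'x word set" where
  "words_on X = lists (X \<times> UNIV)"

definition cancel_step :: "'x set \<Rightarrow> ('x word \<times> 'x word) set" where
  "cancel_step X =
     {(u @ [(x, b), (x, \<not> b)] @ v, u @ v) | u v x b. u \<in> words_on X \<and> v \<in> words_on X \<and> x \<in> X}"

definition free_eq :: "'x set \<Rightarrow> ('x word \<times> 'x word) set" where
  "free_eq X = (cancel_step X \<union> (cancel_step X)\<inverse>)\<^sup>* \<inter> words_on X \<times> words_on X"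

definition word_class :: "'x set \<Rightarrow> 'x word \<Rightarrow> 'x word set" where
  "word_class X w = free_eq X `` {w}"

definition free_group :: "'x set \<Rightarrow> 'x word set monoid" where
  "free_group X =
     \<lparr>carrier = words_on X // free_eq X,
      monoid.mult = (\<lambda>A B. \<Union>u\<in>A. \<Union>v\<in>B. word_class X (u @ v)),
      one = word_class X []\<rparr>"

definition free_gen :: "'x set \<Rightarrow> 'x \<Rightarrow> 'x word set" where
  "free_gen X x = word_class X [(x, True)]"


section \<open>Groups given by generators and relations\<close>

definition normal_closure :: "('a, 'b) monoid_scheme \<Rightarrow> 'a set \<Rightarrow> 'a set" where
  "normal_closure G S = \<Inter> {N. N \<lhd> G \<and> S \<subseteq> N}"

text \<open>A pair \<open>(u, v)\<close> of elements of the free group stands for the relation \<open>u = v\<close>.\<close>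

definition relators :: "'x set \<Rightarrow> ('x word set \<times> 'x word set) set \<Rightarrow> 'x word set set" where
  "relators X E =
     {u \<otimes>\<^bsub>free_group X\<^esub> inv\<^bsub>free_group X\<^esub> v | u v. (u, v) \<in> E}"

definition presented_group ::
  "'x set \<Rightarrow> ('x word set \<times> 'x word set) set \<Rightarrow> 'x word set set monoid" where
  "presented_group X E = free_group X Mod normal_closure (free_group X) (relators X E)"

definition presented_gen ::
  "'x set \<Rightarrow> ('x word set \<times> 'x word set) set \<Rightarrow> 'x \<Rightarrow> 'x word set set" where
  "presented_gen X E x =
     normal_closure (free_group X) (relators X E) #>\<^bsub>free_group X\<^esub> free_gen X x"


section \<open>Lower central series and torsion\<close>

definition commutator_subgroup :: "('a, 'b) monoid_scheme \<Rightarrow> 'a set \<Rightarrow> 'a set \<Rightarrow> 'a set" where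
  "commutator_subgroup G H K =
     generate G (\<Union>h\<in>H. \<Union>k\<in>K. {h \<otimes>\<^bsub>G\<^esub> k \<otimes>\<^bsub>G\<^esub> inv\<^bsub>G\<^esub> h \<otimes>\<^bsub>G\<^esub> inv\<^bsub>G\<^esub> k})"

text \<open>The series is indexed from 1; the value at index 0 is a dummy.\<close>

fun lower_central :: "('a, 'b) monoid_scheme \<Rightarrow> nat \<Rightarrow> 'a set" where
  "lower_central G 0 = carrier G"
| "lower_central G (Suc 0) = carrier G"
| "lower_central G (Suc (Suc k)) = commutator_subgroup G (lower_central G (Suc k)) (carrier G)"

definition torsion_elements :: "('a, 'b) monoid_scheme \<Rightarrow> 'a set" where
  "torsion_elements G = {g \<in> carrier G. \<exists>k::nat. k \<ge> 1 \<and> g [^]\<^bsub>G\<^esub> k = \<one>\<^bsub>G\<^esub>}"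


section \<open>The groups \<open>\<Gamma>\<^sub>n\<close> and \<open>\<Gamma>\<^sub>n\<^sub>,\<^sub>c\<close>\<close>

datatype gamma_gen = Gen_a | Gen_t nat

definition gamma_gens :: "nat \<Rightarrow> gamma_gen set" where
  "gamma_gens r = insert Gen_a (Gen_t ` {1..r})"

definition gamma_rels ::
  "nat \<Rightarrow> (nat \<Rightarrow> nat) \<Rightarrow> (nat \<Rightarrow> nat) \<Rightarrow> (gamma_gen word set \<times> gamma_gen word set) set" where
  "gamma_rels r p y =
     (let F = free_group (gamma_gens r);
          a = free_gen (gamma_gens r) Gen_a;
          t = (\<lambda>i. free_gen (gamma_gens r) (Gen_t i))
      in {(t i \<otimes>\<^bsub>F\<^esub> t j, t j \<otimes>\<^bsub>F\<^esub> t i) | i j. i \<in> {1..r} \<and> j \<in> {1..r} \<and> i \<noteq> j} \<union>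
         {(t i \<otimes>\<^bsub>F\<^esub> a \<otimes>\<^bsub>F\<^esub> inv\<^bsub>F\<^esub> (t i), a [^]\<^bsub>F\<^esub> (p i ^ y i)) | i. i \<in> {1..r}})"

text \<open>
  The integer \<open>n = (\<Prod>i = 1..r. p i ^ y i)\<close> enters only through its prime decomposition, so the
  group \<open>\<Gamma>\<^sub>n\<close> is a function of \<open>r\<close>, \<open>p\<close> and \<open>y\<close>.
\<close>

definition Gamma :: "nat \<Rightarrow> (nat \<Rightarrow> nat) \<Rightarrow> (nat \<Rightarrow> nat) \<Rightarrow> gamma_gen word set set monoid" where
  "Gamma r p y = presented_group (gamma_gens r) (gamma_rels r p y)"

definition Gamma_a :: "nat \<Rightarrow> (nat \<Rightarrow> nat) \<Rightarrow> (nat \<Rightarrow> nat) \<Rightarrow> gamma_gen word set set" where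
  "Gamma_a r p y = presented_gen (gamma_gens r) (gamma_rels r p y) Gen_a"

definition Gamma_quot ::
  "nat \<Rightarrow> (nat \<Rightarrow> nat) \<Rightarrow> (nat \<Rightarrow> nat) \<Rightarrow> nat \<Rightarrow> gamma_gen word set set set monoid" where
  "Gamma_quot r p y c = Gamma r p y Mod lower_central (Gamma r p y) (c + 1)"

definition Gamma_quot_a ::
  "nat \<Rightarrow> (nat \<Rightarrow> nat) \<Rightarrow> (nat \<Rightarrow> nat) \<Rightarrow> nat \<Rightarrow> gamma_gen word set set set" where
  "Gamma_quot_a r p y c =
     lower_central (Gamma r p y) (c + 1) #>\<^bsub>Gamma r p y\<^esub> Gamma_a r p y"


section \<open>The constructions yield groups\<close>

lemma words_on_Nil [simp]: "[] \<in> words_on X"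
  by (simp add: words_on_def)

lemma words_on_append [simp]: "u @ v \<in> words_on X \<longleftrightarrow> u \<in> words_on X \<and> v \<in> words_on X"
  by (auto simp: words_on_def)

lemma words_on_Cons [simp]: "(x, b) # w \<in> words_on X \<longleftrightarrow> x \<in> X \<and> w \<in> words_on X"
  by (auto simp: words_on_def)

lemma cancel_step_append:
  assumes "(v, v') \<in> cancel_step X" "u \<in> words_on X" "w \<in> words_on X"
  shows "(u @ v @ w, u @ v' @ w) \<in> cancel_step X"
proof -
  obtain s t x b where *: "v = s @ [(x, b), (x, \<not> b)] @ t" "v' = s @ t"
    "s \<in> words_on X" "t \<in> words_on X" "x \<in> X"
    using assms(1) by (auto simp: cancel_step_def)
  have "u @ v @ w = (u @ s) @ [(x, b), (x, \<not> b)] @ (t @ w)" "u @ v' @ w = (u @ s) @ (t @ w)"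
    using * by auto
  moreover have "u @ s \<in> words_on X" "t @ w \<in> words_on X" using * assms by auto
  ultimately show ?thesis using \<open>x \<in> X\<close> unfolding cancel_step_def by blast
qed

lemma equiv_free_eq: "equiv (words_on X) (free_eq X)"
proof (rule equivI)
  show "free_eq X \<subseteq> words_on X \<times> words_on X" by (auto simp: free_eq_def)
  show "refl_on (words_on X) (free_eq X)" by (auto simp: free_eq_def refl_on_def)
  have "sym ((cancel_step X \<union> (cancel_step X)\<inverse>)\<^sup>*)"
    by (simp add: sym_Un_converse sym_rtrancl)
  then show "sym (free_eq X)" by (auto simp: free_eq_def sym_def)
  show "trans (free_eq X)" by (auto simp: free_eq_def trans_def)
qed

lemma free_eq_append_context:
  assumes "(v, v') \<in> free_eq X" "u \<in> words_on X" "w \<in> words_on X"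
  shows "(u @ v @ w, u @ v' @ w) \<in> free_eq X"
proof -
  have "(v, v') \<in> (cancel_step X \<union> (cancel_step X)\<inverse>)\<^sup>*" using assms by (auto simp: free_eq_def)
  then have "(u @ v @ w, u @ v' @ w) \<in> (cancel_step X \<union> (cancel_step X)\<inverse>)\<^sup>*"
  proof induction
    case (step s t)
    then have "(u @ s @ w, u @ t @ w) \<in> cancel_step X \<union> (cancel_step X)\<inverse>"
      using cancel_step_append assms(2,3) by blast
    with step show ?case by (meson rtrancl.rtrancl_into_rtrancl)
  qed simp
  then show ?thesis using assms by (auto simp: free_eq_def)
qed

lemma free_eq_append:
  assumes "(u, u') \<in> free_eq X" "(v, v') \<in> free_eq X"
  shows "(u @ v, u' @ v') \<in> free_eq X"
proof -
  have w: "u' \<in> words_on X" "v \<in> words_on X" using assms by (auto simp: free_eq_def)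
  have "(u @ v, u' @ v) \<in> free_eq X" "(u' @ v, u' @ v') \<in> free_eq X"
    using free_eq_append_context[OF assms(1), of "[]" v]
      free_eq_append_context[OF assms(2), of u' "[]"] w by auto
  then show ?thesis using equiv_free_eq by (meson equivE transD)
qed

lemma word_class_eq_iff:
  assumes "u \<in> words_on X" "v \<in> words_on X"
  shows "word_class X u = word_class X v \<longleftrightarrow> (u, v) \<in> free_eq X"
  using assms eq_equiv_class_iff[OF equiv_free_eq] by (simp add: word_class_def)

lemma free_group_carrier: "carrier (free_group X) = word_class X ` words_on X"
  by (auto simp: free_group_def quotient_def word_class_def)

lemma free_group_one: "\<one>\<^bsub>free_group X\<^esub> = word_class X []"
  by (simp add: free_group_def)

lemma free_group_mult:
  assumes "u \<in> words_on X" "v \<in> words_on X"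
  shows "word_class X u \<otimes>\<^bsub>free_group X\<^esub> word_class X v = word_class X (u @ v)"
proof -
  have "word_class X (u' @ v') = word_class X (u @ v)"
    if "u' \<in> word_class X u" "v' \<in> word_class X v" for u' v'
  proof -
    have "(u, u') \<in> free_eq X" "(v, v') \<in> free_eq X" using that by (auto simp: word_class_def)
    then have "(u @ v, u' @ v') \<in> free_eq X" by (rule free_eq_append)
    then show ?thesis
      using equiv_class_eq[OF equiv_free_eq] unfolding word_class_def by metis
  qed
  moreover have "u \<in> word_class X u" "v \<in> word_class X v"
    using assms equiv_class_self[OF equiv_free_eq] by (auto simp: word_class_def)
  ultimately have "(\<Union>u'\<in>word_class X u. \<Union>v'\<in>word_class X v. word_class X (u' @ v')) =
      word_class X (u @ v)"
    by blast
  then show ?thesis by (simp add: free_group_def)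
qed

definition inv_word :: "'x word \<Rightarrow> 'x word" where
  "inv_word w = rev (map (\<lambda>(x, b). (x, \<not> b)) w)"

lemma inv_word_words_on [simp]: "w \<in> words_on X \<Longrightarrow> inv_word w \<in> words_on X"
  by (auto simp: inv_word_def words_on_def)

lemma inv_word_cancel:
  assumes "w \<in> words_on X" shows "(inv_word w @ w, []) \<in> free_eq X"
  using assms
proof (induction w)
  case Nil
  then show ?case by (simp add: inv_word_def free_eq_def)
next
  case (Cons l w)
  obtain x b where l: "l = (x, b)" by fastforce
  have w: "x \<in> X" "w \<in> words_on X" using Cons.prems l by auto
  have "(inv_word w @ [(x, \<not> b), (x, \<not> \<not> b)] @ w, inv_word w @ w) \<in> cancel_step X"
    unfolding cancel_step_def using w inv_word_words_on by blast
  moreover have "inv_word (l # w) @ l # w = inv_word w @ [(x, \<not> b), (x, \<not> \<not> b)] @ w"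
    by (simp add: inv_word_def l)
  ultimately have "(inv_word (l # w) @ l # w, inv_word w @ w) \<in> free_eq X"
    using w by (auto simp: free_eq_def l inv_word_def words_on_def)
  with Cons.IH w show ?case using equiv_free_eq by (meson equivE transD)
qed

lemma group_free_group: "group (free_group X)"
proof (rule groupI)
  fix g assume "g \<in> carrier (free_group X)"
  then obtain w where w: "w \<in> words_on X" "g = word_class X w" by (auto simp: free_group_carrier)
  have "word_class X (inv_word w) \<otimes>\<^bsub>free_group X\<^esub> g = \<one>\<^bsub>free_group X\<^esub>"
    using w inv_word_cancel[OF w(1)] by (simp add: free_group_mult free_group_one word_class_eq_iff)
  then show "\<exists>h\<in>carrier (free_group X). h \<otimes>\<^bsub>free_group X\<^esub> g = \<one>\<^bsub>free_group X\<^esub>"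
    using w by (auto simp: free_group_carrier)
qed (auto simp: free_group_carrier free_group_mult free_group_one)

lemma free_gen_closed: "x \<in> X \<Longrightarrow> free_gen X x \<in> carrier (free_group X)"
  by (simp add: free_gen_def free_group_carrier)

lemma (in group) normal_Inter:
  assumes "\<N> \<noteq> {}" "\<And>N. N \<in> \<N> \<Longrightarrow> N \<lhd> G"
  shows "\<Inter>\<N> \<lhd> G"
proof -
  have "subgroup (\<Inter>\<N>) G"
    using assms by (intro subgroups_Inter) (auto simp: normal_imp_subgroup)
  then show ?thesis using assms by (auto simp: normal_inv_iff)
qed

lemma (in group) normal_closure_normal:
  assumes "S \<subseteq> carrier G" shows "normal_closure G S \<lhd> G"
proof -
  have "carrier G \<lhd> G" by (rule normal_self)
  then show ?thesis unfolding normal_closure_def using assms by (intro normal_Inter) auto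
qed

lemma relators_subset:
  assumes "E \<subseteq> carrier (free_group X) \<times> carrier (free_group X)"
  shows "relators X E \<subseteq> carrier (free_group X)"
proof -
  interpret group "free_group X" by (rule group_free_group)
  show ?thesis using assms by (auto simp: relators_def)
qed

lemma group_presented_group:
  assumes "E \<subseteq> carrier (free_group X) \<times> carrier (free_group X)"
  shows "group (presented_group X E)"
  unfolding presented_group_def
  using group.normal_closure_normal[OF group_free_group relators_subset[OF assms]]
  by (rule normal.factorgroup_is_group)

lemma (in group) commutator_subgroup_normal:
  assumes "H \<lhd> G" "K \<lhd> G" shows "commutator_subgroup G H K \<lhd> G"
proof -
  have HK: "H \<subseteq> carrier G" "K \<subseteq> carrier G"
    using assms by (auto simp: normal_imp_subgroup subgroup.subset)
  show ?thesis
    unfolding commutator_subgroup_def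
  proof (rule normal_generateI, goal_cases)
    case 1
    then show ?case using HK by (auto simp: subset_iff)
  next
    case (2 z g)
    then obtain h k where z: "h \<in> H" "k \<in> K" "z = h \<otimes> k \<otimes> inv h \<otimes> inv k" by auto
    define h' k' where "h' = g \<otimes> h \<otimes> inv g" and "k' = g \<otimes> k \<otimes> inv g"
    have hk: "h \<in> carrier G" "k \<in> carrier G" using z HK by auto
    have "h' \<in> H" "k' \<in> K"
      using assms z 2 by (auto simp: h'_def k'_def normal_inv_iff)
    moreover have "inv g \<otimes> (g \<otimes> x) = x" if "x \<in> carrier G" for x
      using 2(2) that by (simp add: m_assoc[symmetric])
    then have "g \<otimes> z \<otimes> inv g = h' \<otimes> k' \<otimes> inv h' \<otimes> inv k'"
      using hk 2(2) by (simp add: z h'_def k'_def inv_mult_group m_assoc)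
    ultimately show ?case by auto
  qed
qed

lemma (in group) lower_central_normal: "lower_central G k \<lhd> G"
proof (induction k)
  case (Suc k)
  then show ?case by (cases k) (simp_all add: commutator_subgroup_normal normal_self)
qed (simp add: normal_self)

lemma gamma_rels_subset:
  "gamma_rels r p y \<subseteq>
     carrier (free_group (gamma_gens r)) \<times> carrier (free_group (gamma_gens r))"
proof -
  interpret group "free_group (gamma_gens r)" by (rule group_free_group)
  have "free_gen (gamma_gens r) Gen_a \<in> carrier (free_group (gamma_gens r))"
    by (intro free_gen_closed) (simp add: gamma_gens_def)
  moreover have "free_gen (gamma_gens r) (Gen_t i) \<in> carrier (free_group (gamma_gens r))"
    if "i \<in> {1..r}" for i
    using that by (intro free_gen_closed) (auto simp: gamma_gens_def)
  ultimately show ?thesis by (auto simp: gamma_rels_def Let_def)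
qed

lemma group_Gamma: "group (Gamma r p y)"
  unfolding Gamma_def by (intro group_presented_group gamma_rels_subset)

lemma group_Gamma_quot: "group (Gamma_quot r p y c)"
  unfolding Gamma_quot_def
  by (intro normal.factorgroup_is_group group.lower_central_normal group_Gamma)

end

theory Submission
  imports Defs "HOL-Algebra.Elementary_Groups" "HOL-Algebra.FiniteProduct"
begin

text \<open>
  Write \<open>m\<^sub>i = p\<^sub>i ^ y\<^sub>i\<close>, and let \<open>N\<close> be the subgroup of \<open>\<Gamma>\<^sub>n\<^sub>,\<^sub>c\<close> generated by the image of \<open>a\<close> and
  the commutators. The two inclusions rest on opposite facts about the generators: the image of
  \<open>a\<close> has finite order, and the quotient by \<open>N\<close> is free abelian on the images of the \<open>t\<^sub>i\<close>.

  Every element of \<open>N\<close> is torsion. Since \<open>t\<^sub>i\<close> conjugates a power \<open>x\<close> of \<open>a\<close> into \<open>x ^ m\<^sub>i\<close>, a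
  commutator of \<open>t\<^sub>i\<close> and \<open>x\<close> is \<open>x ^ (m\<^sub>i - 1)\<close>. Iterating, \<open>a ^ ((m\<^sub>i - 1) ^ c)\<close> lies in the term
  of the lower central series that is divided out (\<open>power_in_lower_central\<close>). As \<open>m\<^sub>i \<ge> 2\<close>, the
  exponent is positive, so the image of \<open>a\<close> has finite order. The torsion passes to \<open>N\<close> as follows:
  conjugation by a product of the \<open>t\<^sub>i\<close> maps powers of \<open>a\<close> to powers of \<open>a\<close>,
  and the elements that some such product moves into the powers of \<open>a\<close> form a normal subgroup
  (\<open>normal_contractible\<close>). Modulo it the generators commute, so it contains \<open>N\<close>
  (\<open>derived_contractible\<close>), and a conjugate of a torsion element is torsion.

  Every torsion element lies in \<open>N\<close>. For each \<open>i\<close> the exponent sum of \<open>t\<^sub>i\<close> respects the relations,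
  hence is a homomorphism \<open>\<phi>\<^sub>i\<close> to the integers (\<open>Gamma_exponent_hom\<close>). It vanishes on torsion.
  Modulo \<open>N\<close> every \<open>x\<close> equals the product of the \<open>t\<^sub>i ^ \<phi>\<^sub>i(x)\<close>, because both sides are
  homomorphisms that agree on the generators (\<open>exponent_zero_imp_generated\<close>).

  Since \<open>a\<close> and the \<open>t\<^sub>i\<close> satisfy the relations and generate both in \<open>\<Gamma>\<^sub>n\<close> and in its quotients, the
  arguments are carried out in a locale of which all these groups are instances. The defining
  property of a presentation, that homomorphisms may be prescribed on generators, enters through
  the \<open>\<phi>\<^sub>i\<close>.
\<close>

section \<open>Commutators, conjugation and generators\<close>

lemma lower_central_2: "lower_central G 2 = derived G (carrier G)"
  by (simp add: numeral_2_eq_2 commutator_subgroup_def derived_def)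

lemma (in group) mult_inv_cancel_left:
  assumes "g \<in> carrier G" "x \<in> carrier G"
  shows "g \<otimes> (inv g \<otimes> x) = x" "inv g \<otimes> (g \<otimes> x) = x"
  using assms by (simp_all flip: m_assoc)

lemma (in group) conjugation_group_hom:
  assumes "g \<in> carrier G"
  shows "group_hom G G (\<lambda>x. g \<otimes> x \<otimes> inv g)"
proof (unfold_locales, rule homI)
  fix x y assume "x \<in> carrier G" "y \<in> carrier G"
  then show "g \<otimes> (x \<otimes> y) \<otimes> inv g = g \<otimes> x \<otimes> inv g \<otimes> (g \<otimes> y \<otimes> inv g)"
    using assms by (simp add: m_assoc mult_inv_cancel_left)
qed (use assms in auto)

lemma (in group) conjugation_mult:
  assumes "g \<in> carrier G" "h \<in> carrier G" "x \<in> carrier G"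
  shows "(g \<otimes> h) \<otimes> x \<otimes> inv (g \<otimes> h) = g \<otimes> (h \<otimes> x \<otimes> inv h) \<otimes> inv g"
  using assms by (simp add: inv_mult_group m_assoc)

lemma (in group) conjugation_inv_cancel:
  assumes "g \<in> carrier G" "x \<in> carrier G"
  shows "g \<otimes> (inv g \<otimes> x \<otimes> g) \<otimes> inv g = x"
  using assms by (simp add: m_assoc mult_inv_cancel_left)

lemma (in group) commutes_generate:
  assumes "S \<subseteq> carrier G" "x \<in> carrier G"
    and "\<And>s. s \<in> S \<Longrightarrow> x \<otimes> s = s \<otimes> x"
    and "y \<in> generate G S"
  shows "x \<otimes> y = y \<otimes> x"
  using assms(4)
proof induction
  case (inv s)
  then have s: "s \<in> carrier G" "x \<otimes> s = s \<otimes> x" using assms by auto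
  have "inv s \<otimes> (x \<otimes> s) \<otimes> inv s = inv s \<otimes> (s \<otimes> x) \<otimes> inv s" using s(2) by simp
  then show ?case using s(1) assms(2) by (simp add: m_assoc mult_inv_cancel_left)
next
  case (eng y z)
  then have yz: "y \<in> carrier G" "z \<in> carrier G" using generate_in_carrier[OF assms(1)] by blast+
  then have "x \<otimes> (y \<otimes> z) = y \<otimes> x \<otimes> z" using eng.IH assms(2) by (simp flip: m_assoc)
  then show ?case using yz eng.IH assms(2) by (simp add: m_assoc)
qed (use assms in auto)

lemma (in group) generate_commutative:
  assumes "S \<subseteq> carrier G"
    and "\<And>s s'. s \<in> S \<Longrightarrow> s' \<in> S \<Longrightarrow> s \<otimes> s' = s' \<otimes> s"
    and "x \<in> generate G S" "y \<in> generate G S"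
  shows "x \<otimes> y = y \<otimes> x"
proof -
  have "x \<otimes> s = s \<otimes> x" if "s \<in> S" for s
    using commutes_generate[OF assms(1) _ _ assms(3), of s] assms(1,2) that by auto
  then show ?thesis
    using commutes_generate[OF assms(1) _ _ assms(4)] generate_in_carrier[OF assms(1,3)] by auto
qed

lemma (in group) commutator_in_derived:
  assumes "g \<in> carrier G" "h \<in> carrier G"
  shows "g \<otimes> h \<otimes> inv g \<otimes> inv h \<in> derived G (carrier G)"
  unfolding derived_def using assms by (intro generate.incl) blast

text \<open>
  A conjugate of \<open>h\<close> differs from \<open>h\<close> by the factor \<open>g h g\<inverse> h\<inverse>\<close>, which is a commutator.
\<close>

lemma (in group) normal_if_derived_subset:
  assumes "subgroup H G" "derived G (carrier G) \<subseteq> H"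
  shows "H \<lhd> G"
proof -
  have "g \<otimes> h \<otimes> inv g \<in> H" if "g \<in> carrier G" "h \<in> H" for g h
  proof -
    have h: "h \<in> carrier G" using that assms(1) subgroup.subset by blast
    have "g \<otimes> h \<otimes> inv g \<otimes> inv h \<in> H"
      using commutator_in_derived[OF that(1) h] assms(2) by blast
    from subgroup.m_closed[OF assms(1) this that(2)]
    show ?thesis using that h by (simp add: m_assoc)
  qed
  then show ?thesis unfolding normal_inv_iff using assms(1) by blast
qed

lemma (in group) comm_group_quotient_if_derived_subset:
  assumes "subgroup H G" "derived G (carrier G) \<subseteq> H"
  shows "comm_group (G Mod H)"
proof -
  interpret H: normal H G by (rule normal_if_derived_subset[OF assms])
  show ?thesis
  proof (rule group.group_comm_groupI[OF H.factorgroup_is_group])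
    fix A B assume "A \<in> carrier (G Mod H)" "B \<in> carrier (G Mod H)"
    then obtain g h where gh: "g \<in> carrier G" "h \<in> carrier G" "A = H #> g" "B = H #> h"
      by (auto simp: carrier_FactGroup)
    have "g \<otimes> h \<otimes> inv g \<otimes> inv h \<in> derived G (carrier G)"
      by (rule commutator_in_derived[OF gh(1,2)])
    moreover have "(g \<otimes> h) \<otimes> inv (h \<otimes> g) = g \<otimes> h \<otimes> inv g \<otimes> inv h"
      using gh by (simp add: inv_mult_group m_assoc)
    ultimately have "g \<otimes> h \<in> H #> (h \<otimes> g)"
      using H.rcos_module[OF is_group] gh assms(2) by auto
    then have "H #> (h \<otimes> g) = H #> (g \<otimes> h)"
      using gh assms(1) by (intro repr_independence) auto
    then show "A \<otimes>\<^bsub>G Mod H\<^esub> B = B \<otimes>\<^bsub>G Mod H\<^esub> A"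
      using gh by (simp add: H.rcos_sum)
  qed
qed

lemma hom_eq_on_generate:
  assumes "group_hom G H f" "group_hom G H g" "S \<subseteq> carrier G"
    and "\<And>s. s \<in> S \<Longrightarrow> f s = g s" and "x \<in> generate G S"
  shows "f x = g x"
proof -
  interpret f: group_hom G H f by fact
  interpret g: group_hom G H g by fact
  show ?thesis
    using assms(5)
  proof induction
    case (inv s)
    then have "s \<in> carrier G" using assms(3) by blast
    then show ?case using assms(4)[OF inv] by simp
  next
    case (eng x y)
    then have "x \<in> carrier G" "y \<in> carrier G"
      using f.G.generate_in_carrier[OF assms(3)] by blast+
    then show ?case using eng.IH by simp
  qed (use assms(4) in auto)
qed

text \<open>
  All terms of the series but the first are generated by commutators, which die in an abelian group.
  This makes the exponent sums factor through \<open>\<Gamma>\<^sub>n\<^sub>,\<^sub>c\<close> as soon as \<open>c \<ge> 1\<close>.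
\<close>

lemma lower_central_subset_kernel:
  assumes "group_hom G H h" "comm_group H"
  shows "lower_central G (Suc (Suc k)) \<subseteq> kernel G H h"
proof -
  interpret group_hom G H h by fact
  interpret H: comm_group H by fact
  have "lower_central G (Suc k) \<subseteq> carrier G"
    using G.lower_central_normal normal_imp_subgroup subgroup.subset by blast
  moreover have "h (x \<otimes>\<^bsub>G\<^esub> y \<otimes>\<^bsub>G\<^esub> inv\<^bsub>G\<^esub> x \<otimes>\<^bsub>G\<^esub> inv\<^bsub>G\<^esub> y) = \<one>\<^bsub>H\<^esub>"
    if "x \<in> carrier G" "y \<in> carrier G" for x y
  proof -
    have "h x \<otimes>\<^bsub>H\<^esub> h y = h y \<otimes>\<^bsub>H\<^esub> h x" using that by (intro H.m_comm) auto
    then show ?thesis using that by (simp add: H.m_assoc H.mult_inv_cancel_left)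
  qed
  ultimately have "x \<otimes>\<^bsub>G\<^esub> y \<otimes>\<^bsub>G\<^esub> inv\<^bsub>G\<^esub> x \<otimes>\<^bsub>G\<^esub> inv\<^bsub>G\<^esub> y \<in> kernel G H h"
    if "x \<in> lower_central G (Suc k)" "y \<in> carrier G" for x y
    using that by (auto simp: kernel_def subset_iff)
  then show ?thesis
    unfolding lower_central.simps commutator_subgroup_def
    by (intro G.generate_subgroup_incl subgroup_kernel) blast
qed

section \<open>Homomorphisms out of a presented group\<close>

definition eval_word :: "('h, 'b) monoid_scheme \<Rightarrow> ('x \<Rightarrow> 'h) \<Rightarrow> 'x word \<Rightarrow> 'h" where
  "eval_word H f w =
     foldr (\<lambda>(x, b) g. (if b then f x else inv\<^bsub>H\<^esub> f x) \<otimes>\<^bsub>H\<^esub> g) w \<one>\<^bsub>H\<^esub>"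

context group
begin

lemma eval_word_closed:
  assumes "f \<in> X \<rightarrow> carrier G" "w \<in> words_on X"
  shows "eval_word G f w \<in> carrier G"
  using assms(2)
proof (induction w)
  case (Cons l w)
  then show ?case using assms(1) by (cases l) (auto simp: eval_word_def Pi_iff)
qed (simp add: eval_word_def)

lemma eval_word_append:
  assumes "f \<in> X \<rightarrow> carrier G" "u \<in> words_on X" "v \<in> words_on X"
  shows "eval_word G f (u @ v) = eval_word G f u \<otimes> eval_word G f v"
  using assms(2)
proof (induction u)
  case Nil
  then show ?case using eval_word_closed[OF assms(1,3)] by (simp add: eval_word_def)
next
  case (Cons l u)
  obtain x b where l: "l = (x, b)" by fastforce
  have "f x \<in> carrier G" "u \<in> words_on X" using Cons.prems assms(1) l by auto
  then show ?case
    using Cons.IH eval_word_closed[OF assms(1)] assms(3)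
    by (simp add: eval_word_def l m_assoc)
qed

lemma eval_word_cancel_step:
  assumes f: "f \<in> X \<rightarrow> carrier G" and "(v, w) \<in> cancel_step X"
  shows "eval_word G f v = eval_word G f w"
proof -
  obtain s t x b where *: "v = s @ [(x, b), (x, \<not> b)] @ t" "w = s @ t"
    "s \<in> words_on X" "t \<in> words_on X" "x \<in> X"
    using assms(2) by (auto simp: cancel_step_def)
  have "eval_word G f [(x, b), (x, \<not> b)] = \<one>"
    using * f by (auto simp: eval_word_def Pi_iff)
  then show ?thesis
    using * eval_word_closed[OF f] by (simp add: eval_word_append[OF f] del: append_Cons)
qed

lemma eval_word_free_eq:
  assumes "f \<in> X \<rightarrow> carrier G" "(v, w) \<in> free_eq X"
  shows "eval_word G f v = eval_word G f w"
proof -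
  have "(v, w) \<in> (cancel_step X \<union> (cancel_step X)\<inverse>)\<^sup>*"
    using assms(2) by (simp add: free_eq_def)
  then show ?thesis
    by induction (use eval_word_cancel_step[OF assms(1)] in auto)
qed

text \<open>
  The values of a word at the letters are invariant under cancellation, so evaluating any
  representative of a class gives a well-defined homomorphism.
\<close>

lemma free_group_universal:
  assumes f: "f \<in> X \<rightarrow> carrier G"
  obtains h where "h \<in> hom (free_group X) G" "\<And>x. x \<in> X \<Longrightarrow> h (free_gen X x) = f x"
proof -
  \<comment> \<open>By invariance of the value, the choice of the representative is irrelevant.\<close>
  define h where "h A = eval_word G f (SOME w. w \<in> A)" for A
  have h: "h (word_class X w) = eval_word G f w" if "w \<in> words_on X" for w
  proof -
    have "w \<in> word_class X w"
      using that equiv_class_self[OF equiv_free_eq] by (auto simp: word_class_def)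
    then have "(SOME v. v \<in> word_class X w) \<in> word_class X w" by (rule someI)
    then show ?thesis
      using eval_word_free_eq[OF f] by (auto simp: h_def word_class_def)
  qed
  show thesis
  proof
    show "h \<in> hom (free_group X) G"
      by (rule homI)
        (auto simp: free_group_carrier free_group_mult h eval_word_append[OF f]
          eval_word_closed[OF f])
    show "h (free_gen X x) = f x" if "x \<in> X" for x
      using that f by (auto simp: free_gen_def h eval_word_def Pi_iff)
  qed
qed

end

text \<open>
  A word is the product of its letters; a letter with flag \<open>False\<close> has the class of the inverse of
  its generator.
\<close>

lemma generate_free_group: "generate (free_group X) (free_gen X ` X) = carrier (free_group X)"
proof -
  interpret group "free_group X" by (rule group_free_group)
  have sub: "free_gen X ` X \<subseteq> carrier (free_group X)" by (auto intro: free_gen_closed)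
  have "word_class X w \<in> generate (free_group X) (free_gen X ` X)" if "w \<in> words_on X" for w
    using that
  proof (induction w)
    case Nil
    then show ?case using generate.one[of "free_group X"] by (simp add: free_group_one)
  next
    case (Cons l w)
    obtain x b where l: "l = (x, b)" by fastforce
    have x: "x \<in> X" "w \<in> words_on X" using Cons.prems l by auto
    have gen: "free_gen X x \<in> free_gen X ` X" using x(1) by (rule imageI)
    have "word_class X [(x, False)] \<otimes>\<^bsub>free_group X\<^esub> free_gen X x = \<one>\<^bsub>free_group X\<^esub>"
      using x inv_word_cancel[of "[(x, True)]" X]
      by (simp add: free_gen_def free_group_mult free_group_one word_class_eq_iff inv_word_def)
    then have "word_class X [(x, False)] = inv\<^bsub>free_group X\<^esub> free_gen X x"
      using x inv_equality free_gen_closed[OF x(1)] by (metis free_group_carrier imageI words_on_Cons words_on_Nil)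
    then have "word_class X [l] \<in> generate (free_group X) (free_gen X ` X)"
      using generate.incl[OF gen] generate.inv[OF gen]
      by (cases b) (simp_all add: l, simp add: free_gen_def)
    moreover have "word_class X (l # w) = word_class X [l] \<otimes>\<^bsub>free_group X\<^esub> word_class X w"
      using x by (simp add: free_group_mult l)
    ultimately show ?case using Cons.IH x generate.eng by metis
  qed
  then show ?thesis using generate_incl[OF sub] by (auto simp: free_group_carrier)
qed

context
  fixes X :: "'x set" and E
  assumes E: "E \<subseteq> carrier (free_group X) \<times> carrier (free_group X)"
begin

lemma normal_relators: "normal_closure (free_group X) (relators X E) \<lhd> free_group X"
  by (rule group.normal_closure_normal[OF group_free_group relators_subset[OF E]])

lemma presented_projection:
  "group_hom (free_group X) (presented_group X E)
     (\<lambda>g. normal_closure (free_group X) (relators X E) #>\<^bsub>free_group X\<^esub> g)"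
  using normal.r_coset_hom_Mod[OF normal_relators] group_free_group group_presented_group[OF E]
  by (simp add: group_hom_def group_hom_axioms_def presented_group_def)

lemma generate_presented_group:
  "generate (presented_group X E) (presented_gen X E ` X) = carrier (presented_group X E)"
proof -
  interpret P: group_hom "free_group X" "presented_group X E"
    "\<lambda>g. normal_closure (free_group X) (relators X E) #>\<^bsub>free_group X\<^esub> g"
    by (rule presented_projection)
  have "free_gen X ` X \<subseteq> carrier (free_group X)" by (auto intro: free_gen_closed)
  from P.generate_img[OF this] show ?thesis
    by (simp add: generate_free_group image_image presented_gen_def[symmetric])
      (simp add: presented_group_def carrier_FactGroup)
qed

lemma presented_relation:
  assumes "(u, v) \<in> E"
  shows "normal_closure (free_group X) (relators X E) #>\<^bsub>free_group X\<^esub> u =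
    normal_closure (free_group X) (relators X E) #>\<^bsub>free_group X\<^esub> v"
proof -
  interpret F: group "free_group X" by (rule group_free_group)
  interpret N: normal "normal_closure (free_group X) (relators X E)" "free_group X"
    by (rule normal_relators)
  have uv: "u \<in> carrier (free_group X)" "v \<in> carrier (free_group X)" using E assms by auto
  have "u \<otimes>\<^bsub>free_group X\<^esub> inv\<^bsub>free_group X\<^esub> v \<in> normal_closure (free_group X) (relators X E)"
    using assms by (auto simp: normal_closure_def relators_def)
  then have "u \<in> normal_closure (free_group X) (relators X E) #>\<^bsub>free_group X\<^esub> v"
    using N.rcos_module[OF group_free_group] uv by auto
  then show ?thesis
    using F.repr_independence[OF _ uv(2) N.subgroup_axioms] by simp
qed

text \<open>
  If \<open>h\<close> respects the relations, its kernel is a normal subgroup containing the relators, hence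
  contains their normal closure, and \<open>h\<close> factors through the quotient.
\<close>

lemma presented_group_universal:
  assumes "group H" "h \<in> hom (free_group X) H" "\<And>u v. (u, v) \<in> E \<Longrightarrow> h u = h v"
  obtains k where "k \<in> hom (presented_group X E) H"
    "\<And>x. x \<in> X \<Longrightarrow> k (presented_gen X E x) = h (free_gen X x)"
proof -
  interpret h: group_hom "free_group X" H h
    using assms group_free_group by (simp add: group_hom_def group_hom_axioms_def)
  have "relators X E \<subseteq> kernel (free_group X) H h"
    using E assms(3) by (auto simp: relators_def kernel_def subset_iff)
  then have "normal_closure (free_group X) (relators X E) \<subseteq> kernel (free_group X) H h"
    using h.normal_kernel by (auto simp: normal_closure_def)
  from h.FactGroup_universal_kernel[OF normal_relators this] that show thesis
    unfolding presented_group_def presented_gen_def by (metis free_gen_closed)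
qed

end

section \<open>Groups in which commuting elements raise \<open>a\<close> to powers\<close>

locale power_conjugation_group = group G for G (structure) +
  fixes I :: "'i set" and t :: "'i \<Rightarrow> 'a" and a :: 'a and m :: "'i \<Rightarrow> nat"
  assumes a_closed: "a \<in> carrier G"
    and t_closed: "i \<in> I \<Longrightarrow> t i \<in> carrier G"
    and t_commute: "i \<in> I \<Longrightarrow> j \<in> I \<Longrightarrow> t i \<otimes> t j = t j \<otimes> t i"
    and t_conj: "i \<in> I \<Longrightarrow> t i \<otimes> a \<otimes> inv (t i) = a [^] m i"
    and generated: "generate G (insert a (t ` I)) = carrier G"
begin

lemma generators_closed: "insert a (t ` I) \<subseteq> carrier G"
  using a_closed t_closed by auto

lemma t_conj_power:
  assumes "i \<in> I"
  shows "t i \<otimes> a [^] (k::nat) \<otimes> inv (t i) = a [^] (m i * k)"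
  using group_hom.hom_nat_pow[OF conjugation_group_hom[OF t_closed[OF assms]] a_closed, of k]
  by (simp add: t_conj[OF assms] nat_pow_pow a_closed)

text \<open>
  For a power \<open>x\<close> of \<open>a\<close>, the commutator \<open>t\<^sub>i x t\<^sub>i\<inverse> x\<inverse>\<close> equals \<open>x ^ (m\<^sub>i - 1)\<close>, so each step down the
  series costs one factor \<open>m\<^sub>i - 1\<close> in the exponent.
\<close>

lemma power_in_lower_central:
  assumes "i \<in> I" "m i \<ge> 1"
  shows "a [^] ((m i - 1) ^ c) \<in> lower_central G (Suc c)"
proof (induction c)
  case 0
  then show ?case by (simp add: a_closed)
next
  case (Suc c)
  define k where "k = (m i - 1) ^ c"
  define x where "x = a [^] k"
  have x: "x \<in> carrier G" "x \<in> lower_central G (Suc c)"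
    using Suc a_closed by (auto simp: x_def k_def)
  interpret L: normal "lower_central G (Suc (Suc c))" G by (rule lower_central_normal)
  have "m i * k = (m i - 1) * k + k" using assms(2) by (cases "m i") auto
  then have "t i \<otimes> x \<otimes> inv (t i) = a [^] ((m i - 1) * k) \<otimes> x"
    using t_conj_power[OF assms(1), of k] a_closed by (simp add: x_def nat_pow_mult)
  moreover have "inv (x \<otimes> t i \<otimes> inv x \<otimes> inv (t i)) = t i \<otimes> x \<otimes> inv (t i) \<otimes> inv x"
    using x t_closed[OF assms(1)] by (simp add: inv_mult_group m_assoc)
  \<comment> \<open>The commutators generating the series have the series element on the left, whence the inverse.\<close>
  ultimately have "inv (x \<otimes> t i \<otimes> inv x \<otimes> inv (t i)) = a [^] ((m i - 1) * k)"
    using x a_closed by (simp add: m_assoc)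
  moreover have "x \<otimes> t i \<otimes> inv x \<otimes> inv (t i) \<in> lower_central G (Suc (Suc c))"
    unfolding lower_central.simps commutator_subgroup_def
    using x(2) t_closed[OF assms(1)] by (intro generate.incl) blast
  ultimately show ?case using L.m_inv_closed by (metis k_def power_Suc)
qed

text \<open>
  The typical contractors are the products of the \<open>t\<^sub>i\<close> with nonnegative exponents. Describing them
  by membership and a stability condition spares an enumeration of exponents and keeps what
  matters: contractors commute and are closed under multiplication.
\<close>

definition contractors :: "'a set" where
  "contractors =
     {h \<in> generate G (t ` I). \<forall>x \<in> generate G {a}. h \<otimes> x \<otimes> inv h \<in> generate G {a}}"

text \<open>
  In \<open>\<Gamma>\<^sub>n\<close> the element \<open>t\<^sub>i\<inverse> a t\<^sub>i\<close> is an \<open>m\<^sub>i\<close>-th root of \<open>a\<close>; conjugation by \<open>t\<^sub>i\<close> brings it back to \<open>a\<close>.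
  The contractible elements are those that can be brought into the powers of \<open>a\<close> in this way. They
  turn out to form the normal closure of \<open>a\<close>.
\<close>

definition contractible :: "'a set" where
  "contractible = {x \<in> carrier G. \<exists>h \<in> contractors. h \<otimes> x \<otimes> inv h \<in> generate G {a}}"

lemma contractors_closed: "h \<in> contractors \<Longrightarrow> h \<in> carrier G"
  using generate_in_carrier[of "t ` I"] t_closed by (auto simp: contractors_def)

lemma contractors_commute: "g \<in> contractors \<Longrightarrow> h \<in> contractors \<Longrightarrow> g \<otimes> h = h \<otimes> g"
  using generate_commutative[of "t ` I" g h] t_closed t_commute by (auto simp: contractors_def)

lemma one_contractor: "\<one> \<in> contractors"
  using generate_in_carrier[of "{a}"] a_closed by (auto simp: contractors_def generate.one)

lemma mult_contractor:
  assumes "g \<in> contractors" "h \<in> contractors"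
  shows "g \<otimes> h \<in> contractors"
proof -
  have "(g \<otimes> h) \<otimes> x \<otimes> inv (g \<otimes> h) \<in> generate G {a}" if "x \<in> generate G {a}" for x
    using that assms conjugation_mult[of g h x] contractors_closed
      generate_in_carrier[of "{a}"] a_closed
    by (auto simp: contractors_def)
  then show ?thesis using assms by (auto simp: contractors_def intro: generate.eng)
qed

lemma t_contractor:
  assumes "i \<in> I"
  shows "t i \<in> contractors"
proof -
  interpret c: group_hom G G "\<lambda>x. t i \<otimes> x \<otimes> inv (t i)"
    by (rule conjugation_group_hom[OF t_closed[OF assms]])
  have "a [^] m i \<in> generate G {a}"
    using generate_pow[OF a_closed] int_pow_int by (metis (mono_tags, lifting) UNIV_I mem_Collect_eq)
  then have "generate G {a [^] m i} \<subseteq> generate G {a}"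
    using a_closed generate_is_subgroup by (intro generate_subgroup_incl) auto
  moreover have "(\<lambda>x. t i \<otimes> x \<otimes> inv (t i)) ` generate G {a} = generate G {a [^] m i}"
    using c.generate_img[of "{a}"] a_closed t_conj[OF assms] by simp
  ultimately show ?thesis using assms by (auto simp: contractors_def intro: generate.incl)
qed

lemma contractibleI:
  assumes "x \<in> carrier G" "h \<in> contractors" "h \<otimes> x \<otimes> inv h \<in> generate G {a}"
  shows "x \<in> contractible"
  using assms by (auto simp: contractible_def)

lemma contractor_extend:
  assumes "x \<in> carrier G" "h \<in> contractors" "h \<otimes> x \<otimes> inv h \<in> generate G {a}" "g \<in> contractors"
  shows "(g \<otimes> h) \<otimes> x \<otimes> inv (g \<otimes> h) \<in> generate G {a}"
  using assms conjugation_mult[of g h x] contractors_closed by (auto simp: contractors_def)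

text \<open>
  If \<open>g\<close> contracts \<open>x\<close> and \<open>h\<close> contracts \<open>y\<close>, then \<open>g h = h g\<close> contracts both, since contracting
  further stays within the powers of \<open>a\<close>.
\<close>

lemma subgroup_contractible: "subgroup contractible G"
proof
  interpret A: subgroup "generate G {a}" G
    using a_closed generate_is_subgroup by simp
  show "contractible \<subseteq> carrier G" by (auto simp: contractible_def)
  show "\<one> \<in> contractible"
    using one_contractor by (auto intro!: contractibleI[of _ \<one>] generate.one)
  fix x assume "x \<in> contractible"
  then obtain g where g: "x \<in> carrier G" "g \<in> contractors" "g \<otimes> x \<otimes> inv g \<in> generate G {a}"
    by (auto simp: contractible_def)
  have gc: "g \<in> carrier G" using g contractors_closed by blast
  interpret g: group_hom G G "\<lambda>x. g \<otimes> x \<otimes> inv g" by (rule conjugation_group_hom[OF gc])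
  show "inv x \<in> contractible"
    using g g.hom_inv[of x] A.m_inv_closed[of "g \<otimes> x \<otimes> inv g"] by (auto intro!: contractibleI[of _ g])
  fix y assume "y \<in> contractible"
  then obtain h where h: "y \<in> carrier G" "h \<in> contractors" "h \<otimes> y \<otimes> inv h \<in> generate G {a}"
    by (auto simp: contractible_def)
  have hc: "h \<in> carrier G" using h contractors_closed by blast
  interpret gh: group_hom G G "\<lambda>x. (g \<otimes> h) \<otimes> x \<otimes> inv (g \<otimes> h)"
    using gc hc by (intro conjugation_group_hom) auto
  have "(g \<otimes> h) \<otimes> x \<otimes> inv (g \<otimes> h) \<in> generate G {a}"
    using contractor_extend[OF g h(2)] contractors_commute[OF g(2) h(2)] by simp
  moreover have "(g \<otimes> h) \<otimes> y \<otimes> inv (g \<otimes> h) \<in> generate G {a}"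
    by (rule contractor_extend[OF h g(2)])
  ultimately have "(g \<otimes> h) \<otimes> (x \<otimes> y) \<otimes> inv (g \<otimes> h) \<in> generate G {a}"
    using gh.hom_mult[OF g(1) h(1)] A.m_closed by metis
  then show "x \<otimes> y \<in> contractible"
    using g(1) h(1) mult_contractor[OF g(2) h(2)] by (intro contractibleI) auto
qed

lemma a_contractible: "a \<in> contractible"
  using one_contractor a_closed by (auto intro!: contractibleI[of _ \<one>] generate.incl)

text \<open>
  It suffices to conjugate by generators. Let \<open>h\<close> contract \<open>x\<close>. Since \<open>h\<close> commutes with \<open>t\<^sub>i\<close>, it
  contracts \<open>t\<^sub>i x t\<^sub>i\<inverse>\<close> too, while \<open>h t\<^sub>i\<close> contracts \<open>t\<^sub>i\<inverse> x t\<^sub>i\<close>. Conjugation by \<open>a\<close> stays inside because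
  \<open>a\<close> itself is contractible.
\<close>

lemma normal_contractible: "contractible \<lhd> G"
proof -
  interpret S: subgroup contractible G by (rule subgroup_contractible)
  have t: "t i \<otimes> x \<otimes> inv (t i) \<in> contractible" "inv (t i) \<otimes> x \<otimes> t i \<in> contractible"
    if i: "i \<in> I" and x: "x \<in> contractible" for i x
  proof -
    have ti: "t i \<in> carrier G" "t i \<in> contractors" using i t_closed t_contractor by auto
    obtain h where h: "x \<in> carrier G" "h \<in> contractors" "h \<otimes> x \<otimes> inv h \<in> generate G {a}"
      using x unfolding contractible_def by blast
    have hc: "h \<in> carrier G" using h contractors_closed by blast
    have "h \<otimes> (t i \<otimes> x \<otimes> inv (t i)) \<otimes> inv h = (t i \<otimes> h) \<otimes> x \<otimes> inv (t i \<otimes> h)"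
      using conjugation_mult[OF hc ti(1) h(1)] contractors_commute[OF ti(2) h(2)] by simp
    then show "t i \<otimes> x \<otimes> inv (t i) \<in> contractible"
      using contractor_extend[OF h ti(2)] h ti by (intro contractibleI[of _ h]) simp_all
    have "(h \<otimes> t i) \<otimes> (inv (t i) \<otimes> x \<otimes> t i) \<otimes> inv (h \<otimes> t i) = h \<otimes> x \<otimes> inv h"
      using conjugation_mult[OF hc ti(1)] conjugation_inv_cancel[OF ti(1) h(1)] ti(1) h(1) by simp
    then show "inv (t i) \<otimes> x \<otimes> t i \<in> contractible"
      using mult_contractor[OF h(2) ti(2)] h ti by (intro contractibleI[of _ "h \<otimes> t i"]) simp_all
  qed
  have "g \<otimes> x \<otimes> inv g \<in> contractible"
    if "g \<in> generate G (insert a (t ` I))" "x \<in> contractible" for g x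
    using that
  proof (induction arbitrary: x)
    case one
    then show ?case by simp
  next
    case (incl s)
    then consider "s = a" | i where "i \<in> I" "s = t i" by blast
    then show ?case using t(1) a_contractible incl.prems by cases simp_all
  next
    case (inv s)
    then consider "s = a" | i where "i \<in> I" "s = t i" by blast
    then show ?case using t(2) a_contractible t_closed a_closed inv.prems by cases simp_all
  next
    case (eng g h)
    have "g \<in> carrier G" "h \<in> carrier G" "x \<in> carrier G"
      using eng.hyps(1,2) eng.prems unfolding generated by (auto intro: S.mem_carrier)
    then show ?case using eng.IH(1)[OF eng.IH(2)[OF eng.prems]] by (simp only: conjugation_mult)
  qed
  then show ?thesis unfolding normal_inv_iff generated using subgroup_contractible by blast
qed

text \<open>
  Modulo the contractible elements \<open>a\<close> becomes trivial, so the quotient is generated by the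
  commuting images of the \<open>t\<^sub>i\<close> and is abelian.
\<close>

lemma derived_contractible: "derived G (carrier G) \<subseteq> contractible"
proof (rule derived_minimal[OF normal_contractible])
  interpret S: normal contractible G by (rule normal_contractible)
  let ?q = "\<lambda>x. contractible #> x"
  interpret Q: group "G Mod contractible" by (rule S.factorgroup_is_group)
  interpret q: group_hom G "G Mod contractible" ?q
    using S.r_coset_hom_Mod by unfold_locales
  have gen: "generate (G Mod contractible) (?q ` insert a (t ` I)) = carrier (G Mod contractible)"
    using q.generate_img[OF generators_closed] by (simp add: generated carrier_FactGroup)
  have qa: "?q a = \<one>\<^bsub>G Mod contractible\<^esub>"
    using a_contractible by (simp add: S.rcos_const[OF is_group])
  have comm: "?q x \<otimes>\<^bsub>G Mod contractible\<^esub> ?q y = ?q y \<otimes>\<^bsub>G Mod contractible\<^esub> ?q x"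
    if xy: "x \<in> insert a (t ` I)" "y \<in> insert a (t ` I)" for x y
  proof -
    have c: "x \<in> carrier G" "y \<in> carrier G" using xy generators_closed by blast+
    consider "x = a" | "y = a" | "x \<otimes> y = y \<otimes> x" using xy t_commute by blast
    then show ?thesis
    proof cases
      case 1
      then show ?thesis
        by (simp only: qa Q.l_one[OF q.hom_closed[OF c(2)]] Q.r_one[OF q.hom_closed[OF c(2)]])
    next
      case 2
      then show ?thesis
        by (simp only: qa Q.l_one[OF q.hom_closed[OF c(1)]] Q.r_one[OF q.hom_closed[OF c(1)]])
    next
      case 3
      then show ?thesis by (simp only: q.hom_mult[OF c, symmetric] q.hom_mult[OF c(2,1), symmetric])
    qed
  qed
  have sub: "?q ` insert a (t ` I) \<subseteq> carrier (G Mod contractible)"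
    unfolding gen[symmetric] by (auto intro: generate.incl)
  show "comm_group (G Mod contractible)"
  proof (rule Q.group_comm_groupI)
    fix u v assume "u \<in> carrier (G Mod contractible)" "v \<in> carrier (G Mod contractible)"
    then show "u \<otimes>\<^bsub>G Mod contractible\<^esub> v = v \<otimes>\<^bsub>G Mod contractible\<^esub> u"
      unfolding gen[symmetric]
      by (rule Q.generate_commutative[OF sub, rotated 1]) (elim imageE, hypsubst, rule comm)
  qed
qed

text \<open>
  A contractible element is conjugate to a power of \<open>a\<close>, so the order of \<open>a\<close> kills it.
\<close>

lemma contractible_torsion:
  assumes "d \<ge> 1" "a [^] (d::nat) = \<one>"
  shows "contractible \<subseteq> torsion_elements G"
proof
  fix x assume "x \<in> contractible"
  then obtain h where h: "x \<in> carrier G" "h \<in> contractors" "h \<otimes> x \<otimes> inv h \<in> generate G {a}"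
    by (auto simp: contractible_def)
  have hc: "h \<in> carrier G" using h contractors_closed by blast
  interpret h: group_hom G G "\<lambda>x. h \<otimes> x \<otimes> inv h" by (rule conjugation_group_hom[OF hc])
  obtain k :: int where k: "h \<otimes> x \<otimes> inv h = a [^] k"
    using h(3) generate_pow[OF a_closed] by auto
  have "(a [^] k) [^] int d = (a [^] int d) [^] k"
    using a_closed by (simp add: int_pow_pow mult.commute)
  then have "(a [^] k) [^] d = \<one>" using assms(2) by (simp add: int_pow_int)
  then have "h \<otimes> x [^] d \<otimes> inv h = \<one>" using h.hom_nat_pow[OF h(1), of d] k by simp
  then have "x [^] d = \<one>"
    using hc h(1) by (metis inv_closed inv_equality inv_inv l_cancel_one' m_closed nat_pow_closed)
  then show "x \<in> torsion_elements G" using h(1) assms(1) by (auto simp: torsion_elements_def)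
qed

lemma torsion_exponent_zero:
  assumes "x \<in> torsion_elements G" "\<phi> \<in> hom G integer_group"
  shows "\<phi> x = 0"
proof -
  interpret p: group_hom G integer_group \<phi>
    using assms(2) by (simp add: group_hom_def group_hom_axioms_def is_group)
  obtain k :: nat where k: "x \<in> carrier G" "k \<ge> 1" "x [^] k = \<one>"
    using assms(1) by (auto simp: torsion_elements_def)
  have "int k * \<phi> x = 0" using p.hom_nat_pow[OF k(1), of k] k(3) by simp
  then show ?thesis using k(2) by simp
qed

text \<open>
  The homomorphism \<open>\<psi>\<close> of the proof sends \<open>x\<close> to the product of the \<open>t\<^sub>i ^ \<phi>\<^sub>i(x)\<close> modulo \<open>N\<close>. It
  agrees with the projection on \<open>a\<close> and on each \<open>t\<^sub>j\<close>, hence everywhere, and it is trivial on the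
  elements whose exponents vanish.
\<close>

lemma exponent_zero_imp_generated:
  assumes "finite I"
    and \<phi>: "\<And>i. i \<in> I \<Longrightarrow> \<phi> i \<in> hom G integer_group"
    and \<phi>_a: "\<And>i. i \<in> I \<Longrightarrow> \<phi> i a = 0"
    and \<phi>_t: "\<And>i j. i \<in> I \<Longrightarrow> j \<in> I \<Longrightarrow> \<phi> i (t j) = (if i = j then 1 else 0)"
    and x: "x \<in> carrier G" "\<And>i. i \<in> I \<Longrightarrow> \<phi> i x = 0"
  shows "x \<in> generate G (insert a (derived G (carrier G)))"
proof -
  define N where "N = generate G (insert a (derived G (carrier G)))"
  have sub: "subgroup N G" "derived G (carrier G) \<subseteq> N" "a \<in> N"
    using a_closed derived_in_carrier[of "carrier G"]
    by (auto simp: N_def intro!: generate_is_subgroup generate.incl)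
  interpret N: normal N G by (rule normal_if_derived_subset[OF sub(1,2)])
  interpret Q: comm_group "G Mod N" by (rule comm_group_quotient_if_derived_subset[OF sub(1,2)])
  interpret q: group_hom G "G Mod N" "\<lambda>x. N #> x"
    using N.r_coset_hom_Mod by unfold_locales
  define \<psi> where
    "\<psi> = (\<lambda>x. finprod (G Mod N) (\<lambda>i. (N #> t i) [^]\<^bsub>G Mod N\<^esub> \<phi> i x) I)"
  have closed: "(\<lambda>i. (N #> t i) [^]\<^bsub>G Mod N\<^esub> \<phi> i x) \<in> I \<rightarrow> carrier (G Mod N)" for x
    using t_closed q.hom_closed by blast
  have "\<psi> \<in> hom G (G Mod N)"
  proof (rule homI)
    show "\<psi> x \<in> carrier (G Mod N)" for x
      unfolding \<psi>_def using closed by (rule Q.finprod_closed)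
    show "\<psi> (x \<otimes> y) = \<psi> x \<otimes>\<^bsub>G Mod N\<^esub> \<psi> y" if "x \<in> carrier G" "y \<in> carrier G" for x y
    proof -
      have "(N #> t i) [^]\<^bsub>G Mod N\<^esub> \<phi> i (x \<otimes> y) =
          (N #> t i) [^]\<^bsub>G Mod N\<^esub> \<phi> i x \<otimes>\<^bsub>G Mod N\<^esub> (N #> t i) [^]\<^bsub>G Mod N\<^esub> \<phi> i y" if i: "i \<in> I" for i
        using hom_mult[OF \<phi>[OF i] \<open>x \<in> carrier G\<close> \<open>y \<in> carrier G\<close>]
          Q.int_pow_mult[OF q.hom_closed[OF t_closed[OF i]]] by simp
      then have "\<psi> (x \<otimes> y) = finprod (G Mod N) (\<lambda>i. (N #> t i) [^]\<^bsub>G Mod N\<^esub> \<phi> i x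
          \<otimes>\<^bsub>G Mod N\<^esub> (N #> t i) [^]\<^bsub>G Mod N\<^esub> \<phi> i y) I"
        unfolding \<psi>_def using closed[of x] closed[of y]
        by (intro Q.finprod_cong') (auto simp: Pi_iff simp del: mult_FactGroup)
      also have "\<dots> = \<psi> x \<otimes>\<^bsub>G Mod N\<^esub> \<psi> y"
        unfolding \<psi>_def using closed by (intro Q.finprod_multf)
      finally show ?thesis .
    qed
  qed
  then have \<psi>: "group_hom G (G Mod N) \<psi>" by unfold_locales
  have "N #> s = \<psi> s" if s: "s \<in> insert a (t ` I)" for s
  proof (cases "s = a")
    case True
    have "\<psi> a = \<one>\<^bsub>G Mod N\<^esub>"
      unfolding \<psi>_def by (intro Q.finprod_one_eqI) (simp add: \<phi>_a del: one_FactGroup)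
    then show ?thesis using True sub(3) by (simp add: N.rcos_const[OF is_group])
  next
    case False
    then obtain j where j: "j \<in> I" "s = t j" using s by blast
    have "\<psi> s = finprod (G Mod N) (\<lambda>i. if j = i then N #> t i else \<one>\<^bsub>G Mod N\<^esub>) I"
      unfolding \<psi>_def using j q.hom_closed t_closed
      by (intro Q.finprod_cong') (auto simp: \<phi>_t simp del: one_FactGroup)
    also have "\<dots> = N #> t j"
      using j assms(1) q.hom_closed t_closed by (intro Q.finprod_singleton) auto
    finally show ?thesis using j by simp
  qed
  then have "N #> x = \<psi> x"
    using hom_eq_on_generate[OF q.group_hom_axioms \<psi> generators_closed] x(1)
    by (simp add: generated)
  also have "\<psi> x = \<one>\<^bsub>G Mod N\<^esub>"
    unfolding \<psi>_def by (intro Q.finprod_one_eqI) (simp add: x(2) del: one_FactGroup)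
  finally have "N #> x = N" by simp
  then show ?thesis using x(1) N_def N.subgroup_axioms rcos_self by blast
qed

theorem torsion_elements_eq_generate:
  assumes "finite I" and "d \<ge> 1" "a [^] (d::nat) = \<one>"
    and "\<And>i. i \<in> I \<Longrightarrow> \<phi> i \<in> hom G integer_group"
    and "\<And>i. i \<in> I \<Longrightarrow> \<phi> i a = 0"
    and "\<And>i j. i \<in> I \<Longrightarrow> j \<in> I \<Longrightarrow> \<phi> i (t j) = (if i = j then 1 else 0)"
  shows "torsion_elements G = generate G (insert a (lower_central G 2))"
proof
  show "torsion_elements G \<subseteq> generate G (insert a (lower_central G 2))"
  proof
    fix x assume x: "x \<in> torsion_elements G"
    then have "x \<in> carrier G" by (simp add: torsion_elements_def)
    then show "x \<in> generate G (insert a (lower_central G 2))"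
      using exponent_zero_imp_generated[of \<phi> x] torsion_exponent_zero[OF x] assms
      by (simp add: lower_central_2)
  qed
  have "generate G (insert a (derived G (carrier G))) \<subseteq> contractible"
    using a_contractible derived_contractible subgroup_contractible
    by (intro generate_subgroup_incl) auto
  then show "generate G (insert a (lower_central G 2)) \<subseteq> torsion_elements G"
    using contractible_torsion[OF assms(2,3)] by (simp add: lower_central_2)
qed

lemma power_conjugation_group_quotient:
  assumes "N \<lhd> G"
  shows "power_conjugation_group (G Mod N) I (\<lambda>i. N #> t i) (N #> a) m"
proof -
  interpret N: normal N G by fact
  interpret Q: group "G Mod N" by (rule N.factorgroup_is_group)
  interpret q: group_hom G "G Mod N" "\<lambda>x. N #> x"
    using N.r_coset_hom_Mod by unfold_locales
  show ?thesis
  proof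
    show "N #> a \<in> carrier (G Mod N)" using q.hom_closed a_closed .
    show "N #> t i \<in> carrier (G Mod N)" if "i \<in> I" for i
      using q.hom_closed t_closed[OF that] .
    show "(N #> t i) \<otimes>\<^bsub>G Mod N\<^esub> (N #> t j) = (N #> t j) \<otimes>\<^bsub>G Mod N\<^esub> (N #> t i)"
      if "i \<in> I" "j \<in> I" for i j
      by (simp only: q.hom_mult[symmetric] t_closed that t_commute[OF that])
    show "(N #> t i) \<otimes>\<^bsub>G Mod N\<^esub> (N #> a) \<otimes>\<^bsub>G Mod N\<^esub> inv\<^bsub>G Mod N\<^esub> (N #> t i) =
        (N #> a) [^]\<^bsub>G Mod N\<^esub> m i" if "i \<in> I" for i
      by (simp only: q.hom_inv[symmetric] q.hom_mult[symmetric] q.hom_nat_pow[symmetric]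
          t_closed a_closed that inv_closed m_closed t_conj)
    show "generate (G Mod N) (insert (N #> a) ((\<lambda>i. N #> t i) ` I)) = carrier (G Mod N)"
      using q.generate_img[OF generators_closed]
      by (simp add: generated carrier_FactGroup image_image)
  qed
qed

end

section \<open>The groups \<open>\<Gamma>\<^sub>n\<close>\<close>

definition Gamma_t :: "nat \<Rightarrow> (nat \<Rightarrow> nat) \<Rightarrow> (nat \<Rightarrow> nat) \<Rightarrow> nat \<Rightarrow> gamma_gen word set set" where
  "Gamma_t r p y i = presented_gen (gamma_gens r) (gamma_rels r p y) (Gen_t i)"

text \<open>
  The instance reads the defining relations of \<open>\<Gamma>\<^sub>n\<close> off the projection from the free group.
\<close>

lemma power_conjugation_group_Gamma:
  "power_conjugation_group (Gamma r p y) {1..r} (Gamma_t r p y) (Gamma_a r p y) (\<lambda>i. p i ^ y i)"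
proof -
  let ?X = "gamma_gens r" and ?E = "gamma_rels r p y"
  let ?\<pi> = "\<lambda>g. normal_closure (free_group ?X) (relators ?X ?E) #>\<^bsub>free_group ?X\<^esub> g"
  let ?a = "free_gen ?X Gen_a" and ?t = "\<lambda>i. free_gen ?X (Gen_t i)"
  interpret \<pi>: group_hom "free_group ?X" "Gamma r p y" ?\<pi>
    using presented_projection[OF gamma_rels_subset] by (simp add: Gamma_def)
  have \<pi>a: "Gamma_a r p y = ?\<pi> ?a" and \<pi>t: "Gamma_t r p y i = ?\<pi> (?t i)" for i
    by (simp_all add: Gamma_a_def Gamma_t_def presented_gen_def)
  have a: "?a \<in> carrier (free_group ?X)"
    by (intro free_gen_closed) (simp add: gamma_gens_def)
  have t: "?t i \<in> carrier (free_group ?X)" if "i \<in> {1..r}" for i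
    using that by (intro free_gen_closed) (auto simp: gamma_gens_def)
  show ?thesis
  proof
    show "Gamma_a r p y \<in> carrier (Gamma r p y)" unfolding \<pi>a using a by (rule \<pi>.hom_closed)
    show "Gamma_t r p y i \<in> carrier (Gamma r p y)" if "i \<in> {1..r}" for i
      unfolding \<pi>t using t[OF that] by (rule \<pi>.hom_closed)
    show "Gamma_t r p y i \<otimes>\<^bsub>Gamma r p y\<^esub> Gamma_t r p y j =
        Gamma_t r p y j \<otimes>\<^bsub>Gamma r p y\<^esub> Gamma_t r p y i" if ij: "i \<in> {1..r}" "j \<in> {1..r}" for i j
    proof (cases "i = j")
      case False
      then have "(?t i \<otimes>\<^bsub>free_group ?X\<^esub> ?t j, ?t j \<otimes>\<^bsub>free_group ?X\<^esub> ?t i) \<in> ?E"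
        using ij by (auto simp: gamma_rels_def Let_def)
      from presented_relation[OF gamma_rels_subset this] show ?thesis
        unfolding \<pi>t by (simp only: \<pi>.hom_mult t ij)
    qed simp
    show "Gamma_t r p y i \<otimes>\<^bsub>Gamma r p y\<^esub> Gamma_a r p y \<otimes>\<^bsub>Gamma r p y\<^esub>
        inv\<^bsub>Gamma r p y\<^esub> Gamma_t r p y i = Gamma_a r p y [^]\<^bsub>Gamma r p y\<^esub> (p i ^ y i)"
      if i: "i \<in> {1..r}" for i
    proof -
      have "(?t i \<otimes>\<^bsub>free_group ?X\<^esub> ?a \<otimes>\<^bsub>free_group ?X\<^esub> inv\<^bsub>free_group ?X\<^esub> ?t i,
          ?a [^]\<^bsub>free_group ?X\<^esub> (p i ^ y i)) \<in> ?E"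
        using i unfolding gamma_rels_def Let_def by blast
      from presented_relation[OF gamma_rels_subset this] show ?thesis
        unfolding \<pi>t \<pi>a
        by (simp only: \<pi>.hom_mult \<pi>.hom_inv \<pi>.hom_nat_pow t[OF i] a
            \<pi>.G.inv_closed \<pi>.G.m_closed)
    qed
    have "presented_gen ?X ?E ` ?X = insert (Gamma_a r p y) (Gamma_t r p y ` {1..r})"
      by (simp add: gamma_gens_def Gamma_a_def Gamma_t_def image_image)
    then show "generate (Gamma r p y) (insert (Gamma_a r p y) (Gamma_t r p y ` {1..r})) =
        carrier (Gamma r p y)"
      using generate_presented_group[OF gamma_rels_subset[of r p y]] by (simp add: Gamma_def)
  qed
qed

text \<open>
  Assigning \<open>1\<close> to \<open>t\<^sub>i\<close> and \<open>0\<close> to every other generator respects the relations: the commutation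
  relations because the integers are commutative, and \<open>t\<^sub>j a t\<^sub>j\<inverse> = a ^ m\<^sub>j\<close> because both sides have
  value \<open>0\<close>.
\<close>

lemma Gamma_exponent_hom:
  obtains \<phi> where "\<phi> \<in> hom (Gamma r p y) integer_group" "\<phi> (Gamma_a r p y) = 0"
    "\<And>j. j \<in> {1..r} \<Longrightarrow> \<phi> (Gamma_t r p y j) = (if i = j then 1 else 0)"
proof -
  let ?X = "gamma_gens r" and ?E = "gamma_rels r p y"
  obtain h where h: "h \<in> hom (free_group ?X) integer_group"
    "\<And>x. x \<in> ?X \<Longrightarrow> h (free_gen ?X x) = (if x = Gen_t i then 1 else 0)"
    using group.free_group_universal[OF group_integer_group,
        of "\<lambda>x. if x = Gen_t i then 1 else 0" ?X] by auto
  interpret h: group_hom "free_group ?X" integer_group h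
    using h(1) group_free_group by (simp add: group_hom_def group_hom_axioms_def)
  have X: "Gen_a \<in> ?X" "\<And>j. j \<in> {1..r} \<Longrightarrow> Gen_t j \<in> ?X" by (auto simp: gamma_gens_def)
  have c: "free_gen ?X x \<in> carrier (free_group ?X)" if "x \<in> ?X" for x
    by (rule free_gen_closed[OF that])
  have "h u = h v" if uv: "(u, v) \<in> ?E" for u v
    using uv X c by (auto simp: gamma_rels_def Let_def h(2) h.hom_nat_pow)
  then obtain k where k: "k \<in> hom (presented_group ?X ?E) integer_group"
    "\<And>x. x \<in> ?X \<Longrightarrow> k (presented_gen ?X ?E x) = h (free_gen ?X x)"
    using presented_group_universal[OF gamma_rels_subset group_integer_group h(1)] by metis
  show thesis
    by (rule that[of k]) (use k X h(2) in \<open>auto simp: Gamma_def Gamma_a_def Gamma_t_def\<close>)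
qed

theorem proposition2p5:
  fixes n r c :: nat and p y :: "nat \<Rightarrow> nat"
  assumes "n \<ge> 2"
    and "n = (\<Prod>i = 1..r. p i ^ y i)"
    and "\<And>i. i \<in> {1..r} \<Longrightarrow> prime (p i)"
    and "inj_on p {1..r}"
    and "\<And>i. i \<in> {1..r} \<Longrightarrow> y i > 0"
    and "c \<ge> 1"
  shows "torsion_elements (Gamma_quot r p y c) =
    generate (Gamma_quot r p y c)
      (insert (Gamma_quot_a r p y c) (lower_central (Gamma_quot r p y c) 2))"
proof -
  let ?G = "Gamma r p y"
  define N where "N = lower_central ?G (c + 1)"
  interpret G: power_conjugation_group ?G "{1..r}" "Gamma_t r p y" "Gamma_a r p y" "\<lambda>i. p i ^ y i"
    by (rule power_conjugation_group_Gamma)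
  interpret N: normal N ?G unfolding N_def by (rule G.lower_central_normal)
  interpret Q: power_conjugation_group "?G Mod N" "{1..r}" "\<lambda>i. N #>\<^bsub>?G\<^esub> Gamma_t r p y i"
    "N #>\<^bsub>?G\<^esub> Gamma_a r p y" "\<lambda>i. p i ^ y i"
    by (rule G.power_conjugation_group_quotient[OF N.normal_axioms])
  have "r \<noteq> 0" using assms(1,2) by (cases r) simp_all
  then have one: "1 \<in> {1..r}" by simp
  \<comment> \<open>Any \<open>t\<^sub>i\<close> forces \<open>a\<close> to have finite order, and \<open>n \<ge> 2\<close> provides \<open>t\<^sub>1\<close>.\<close>
  have m: "p 1 ^ y 1 \<ge> 2"
    using assms(3,5)[OF one] prime_ge_2_nat[of "p 1"] self_le_power[of "p 1" "y 1"] by linarith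
  define d where "d = (p 1 ^ y 1 - 1) ^ c"
  have "d \<ge> 1" using m by (simp add: d_def)
  have "Gamma_a r p y [^]\<^bsub>?G\<^esub> d \<in> N"
    using G.power_in_lower_central[OF one, of c] m by (simp add: N_def d_def)
  then have torsion: "(N #>\<^bsub>?G\<^esub> Gamma_a r p y) [^]\<^bsub>?G Mod N\<^esub> d = \<one>\<^bsub>?G Mod N\<^esub>"
    using G.a_closed by (simp add: N.FactGroup_pow N.rcos_const[OF G.is_group])
  have "\<exists>\<phi>. \<phi> \<in> hom (?G Mod N) integer_group \<and> \<phi> (N #>\<^bsub>?G\<^esub> Gamma_a r p y) = 0 \<and>
      (\<forall>j\<in>{1..r}. \<phi> (N #>\<^bsub>?G\<^esub> Gamma_t r p y j) = (if i = j then 1 else 0))" for i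
  proof -
    obtain \<phi> where \<phi>: "\<phi> \<in> hom ?G integer_group" "\<phi> (Gamma_a r p y) = 0"
      "\<And>j. j \<in> {1..r} \<Longrightarrow> \<phi> (Gamma_t r p y j) = (if i = j then 1 else 0)"
      using Gamma_exponent_hom[of r p y i] by blast
    interpret \<phi>: group_hom ?G integer_group \<phi>
      using \<phi>(1) G.is_group by (simp add: group_hom_def group_hom_axioms_def)
    have "N \<subseteq> kernel ?G integer_group \<phi>"
      using lower_central_subset_kernel[OF \<phi>.group_hom_axioms abelian_integer_group, of "c - 1"]
        assms(6) by (simp add: N_def)
    from \<phi>.FactGroup_universal_kernel[OF N.normal_axioms this] obtain k
      where "k \<in> hom (?G Mod N) integer_group" "\<And>x. x \<in> carrier ?G \<Longrightarrow> k (N #>\<^bsub>?G\<^esub> x) = \<phi> x"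
      by blast
    then show ?thesis using \<phi> G.a_closed G.t_closed by (intro exI[of _ k]) auto
  qed
  then obtain \<phi> where "\<And>i. \<phi> i \<in> hom (?G Mod N) integer_group \<and>
      \<phi> i (N #>\<^bsub>?G\<^esub> Gamma_a r p y) = 0 \<and>
      (\<forall>j\<in>{1..r}. \<phi> i (N #>\<^bsub>?G\<^esub> Gamma_t r p y j) = (if i = j then 1 else 0))"
    by metis
  then have "torsion_elements (?G Mod N) =
      generate (?G Mod N) (insert (N #>\<^bsub>?G\<^esub> Gamma_a r p y) (lower_central (?G Mod N) 2))"
    using \<open>d \<ge> 1\<close> torsion by (intro Q.torsion_elements_eq_generate[of d \<phi>]) auto
  then show ?thesis by (simp add: Gamma_quot_def Gamma_quot_a_def N_def)
qed

end
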